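(* Let $\nu$ be a Borel probability measure on $\mathbb{T}$ whose Fourier coefficients do not converge to $0$, that is, $$\limsup_{p\to\infty}\left|\int_{\mathbb{T}} e^{2\pi i p x}\,d\nu(x)\right|>0 .$$ Then there is a set $A\subset\mathbb{T}$ of full Lebesgue measure such that $\nu$ cannot be represented at any $\alpha\in A$; that is, for every $\alpha\in A$ there is no good set $S\subset\mathbb{N}$ with $\mu_{S,\alpha}=\nu$.
   Context: $\mathbb{N}=\{1,2,3,\dots\}$, $\mathbb{T}=\mathbb{R}/\mathbb{Z}$ and $e(\beta)=e^{2\pi i\beta}$. A good set $S\subset\mathbb{N}$ is an infinite set of positive integers which, when listed in increasing order as $s_1<s_2<\dots$, has the property that $\lim_{N\to\infty}\frac1N\sum_{n=1}^N e(s_n\alpha)$ exists for every real number $\alpha$. For a good set $S$ and every $\alpha\in\mathbb{T}$, the weak limit of probability measures $\mu_{S,\alpha}:=\lim_{N\to\infty}\frac1N\sum_{n=1}^N\delta_{s_n\alpha}$ on $\mathbb{T}$ exists (with $s_n\alpha$ taken mod $1$). A Borel probability measure $\nu$ is representable at $\alpha$ if there is a good set $S$ with $\mu_{S,\alpha}=\nu$. *)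

theory Defs
  imports "HOL-Probability.Probability"
begin

definition e :: "real \<Rightarrow> complex" where
  "e \<beta> = exp (2 * complex_of_real pi * \<i> * complex_of_real \<beta>)"

lemma e_cis: "e \<beta> = cis (2 * pi * \<beta>)"
  by (simp add: e_def cis_conv_exp mult_ac)

definition cong_mod_one :: "real \<Rightarrow> real \<Rightarrow> bool" where
  "cong_mod_one x y \<longleftrightarrow> x - y \<in> \<int>"

quotient_type torus = real / cong_mod_one
  morphisms rep_torus to_torus
proof (rule equivpI)
  show "reflp cong_mod_one"
    by (simp add: reflp_def cong_mod_one_def)
  show "symp cong_mod_one"
    unfolding symp_def cong_mod_one_def by (metis Ints_minus minus_diff_eq)
  show "transp cong_mod_one"
    unfolding transp_def cong_mod_one_def by (metis Ints_add diff_add_cancel add_diff_eq)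
qed

lemma to_torus_eq_iff: "to_torus x = to_torus y \<longleftrightarrow> x - y \<in> \<int>"
  by (simp add: torus.abs_eq_iff cong_mod_one_def)

text \<open>The quotient topology.\<close>

instantiation torus :: topological_space
begin

definition open_torus :: "torus set \<Rightarrow> bool" where
  "open_torus U \<longleftrightarrow> open (to_torus -` U)"

instance
  by standard (auto simp: open_torus_def vimage_Union)

end

lemma continuous_on_to_torus: "continuous_on UNIV to_torus"
  by (auto simp: continuous_on_open_vimage open_torus_def)

lemma to_torus_measurable [measurable]: "to_torus \<in> borel \<rightarrow>\<^sub>M borel"
  by (rule borel_measurable_continuous_onI [OF continuous_on_to_torus])

lift_definition torus_e :: "torus \<Rightarrow> complex" is e
proof -
  fix x y assume "cong_mod_one x y"
  then obtain k where "x - y = of_int k"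
    by (auto simp: cong_mod_one_def elim: Ints_cases)
  then have "x = y + of_int k"
    by simp
  then have "2 * pi * x = 2 * pi * y + 2 * pi * of_int k"
    by (simp only: distrib_left)
  then have "e x = cis (2 * pi * y) * cis (2 * pi * of_int k)"
    by (simp only: e_cis cis_mult)
  then show "e x = e y"
    by (simp add: e_cis cis_multiple_2pi)
qed

lemma continuous_on_torus_e: "continuous_on UNIV torus_e"
proof -
  have *: "continuous_on UNIV e"
    unfolding e_def by (intro continuous_intros)
  have "to_torus -` (torus_e -` B) = e -` B" for B
    by (auto simp: torus_e.abs_eq)
  with * show ?thesis
    by (simp add: continuous_on_open_vimage open_torus_def)
qed

lift_definition torus_mult :: "nat \<Rightarrow> torus \<Rightarrow> torus" is "\<lambda>n x. real n * x"
  by (auto simp: cong_mod_one_def simp flip: right_diff_distrib)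

definition torus_lebesgue :: "torus measure" where
  "torus_lebesgue = completion (distr (restrict_space lborel {0..<1}) borel to_torus)"

definition borel_prob :: "'a::topological_space measure \<Rightarrow> bool" where
  "borel_prob M \<longleftrightarrow> prob_space M \<and> sets M = sets borel"

definition weakly_converges ::
  "(nat \<Rightarrow> 'a::topological_space measure) \<Rightarrow> 'a measure \<Rightarrow> bool" where
  "weakly_converges M L \<longleftrightarrow>
     (\<forall>f :: 'a \<Rightarrow> real. continuous_on UNIV f \<longrightarrow> bounded (range f) \<longrightarrow>
        (\<lambda>N. \<integral>x. f x \<partial>M N) \<longlonglongrightarrow> (\<integral>x. f x \<partial>L))"

text \<open>\<^const>\<open>enumerate\<close> lists a set of naturals in increasing order starting from index 0,
  so \<open>s\<^sub>n\<close> is \<open>enumerate S (n - 1)\<close>. The type \<^typ>\<open>nat\<close> contains 0, which is excluded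
  explicitly.\<close>

definition good_set :: "nat set \<Rightarrow> bool" where
  "good_set S \<longleftrightarrow> infinite S \<and> 0 \<notin> S \<and>
     (\<forall>\<alpha>::real. convergent
        (\<lambda>N. (\<Sum>n = 1..N. e (real (enumerate S (n - 1)) * \<alpha>)) / of_nat N))"

text \<open>The measure \<open>1/N (\<delta>\<^bsub>s\<^sub>1\<alpha>\<^esub> + \<dots> + \<delta>\<^bsub>s\<^sub>N\<alpha>\<^esub>)\<close>, as the image of the uniform
  distribution on the indices.\<close>

definition empirical_measure :: "nat set \<Rightarrow> torus \<Rightarrow> nat \<Rightarrow> torus measure" where
  "empirical_measure S \<alpha> N =
     distr (uniform_count_measure {1..N}) borel (\<lambda>n. torus_mult (enumerate S (n - 1)) \<alpha>)"

lemma integral_empirical_measure: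
  fixes f :: "torus \<Rightarrow> real"
  assumes "continuous_on UNIV f"
  shows "(\<integral>x. f x \<partial>empirical_measure S \<alpha> N)
       = (\<Sum>n = 1..N. f (torus_mult (enumerate S (n - 1)) \<alpha>)) / real N"
proof -
  have "f \<in> borel_measurable borel"
    using assms by (rule borel_measurable_continuous_onI)
  then have "(\<integral>x. f x \<partial>empirical_measure S \<alpha> N)
      = (\<integral>n. f (torus_mult (enumerate S (n - 1)) \<alpha>) \<partial>uniform_count_measure {1..N})"
    unfolding empirical_measure_def
    by (intro integral_distr) (auto simp: measurable_def space_uniform_count_measure sets_uniform_count_measure)
  also have "\<dots> = (\<Sum>n = 1..N. f (torus_mult (enumerate S (n - 1)) \<alpha>)) / real N"
    unfolding uniform_count_measure_def
    by (subst lebesgue_integral_point_measure_finite) (auto simp: sum_divide_distrib)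
  finally show ?thesis .
qed

text \<open>For a good set \<open>S\<close>, \<open>\<mu>\<^bsub>S,\<alpha>\<^esub> = \<nu>\<close> is rendered as weak convergence to \<open>\<nu>\<close>.\<close>

definition representable_at :: "torus measure \<Rightarrow> torus \<Rightarrow> bool" where
  "representable_at \<nu> \<alpha> \<longleftrightarrow> (\<exists>S. good_set S \<and> weakly_converges (empirical_measure S \<alpha>) \<nu>)"

end

theory Submission
  imports Defs
begin

text \<open>Suppose \<open>\<alpha>\<close> represents \<open>\<nu>\<close> through a good set \<open>S\<close>, and let \<open>\<phi>\<close> be the pointwise limit of
  the exponential averages of \<open>S\<close>. Testing weak convergence on characters gives
  \<open>\<phi>(p \<alpha>) = \<integral> e(p x) d\<nu>\<close> for every \<open>p\<close> (\<open>representable_fourier\<close>). Since the Fourier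
  coefficients do not tend to zero, there are \<open>\<delta> > 0\<close> and an infinite set \<open>P\<close>, depending on \<open>\<nu>\<close>
  alone, with \<open>|\<phi>(p \<alpha>)| > \<delta>\<close> for all \<open>p \<in> P\<close>.

  On the other hand \<open>\<phi>\<close> cannot be that large on a dense set. It is a pointwise limit of
  continuous functions, hence by Baire's theorem nearly continuous on some interval, and it is
  small in mean square, because the averages over \<open>N\<close> distinct frequencies have mean square
  \<open>1 / N\<close>. So \<open>|\<phi>| < \<delta>\<close> on a nonempty open set (\<open>exp_avg_limit_small_on_open\<close>). This is a
  contradiction as soon as the points \<open>p \<alpha>\<close>, \<open>p \<in> P\<close>, are dense in the torus.

  Density holds for almost every \<open>\<alpha>\<close> and depends only on \<open>P\<close>, so the set of these \<open>\<alpha>\<close>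
  is the required one. That the \<open>\<alpha>\<close> whose \<open>P\<close>-multiples avoid a given nonempty open set form a
  null set (\<open>missing_open_null\<close>) follows from the same mean square identity: integrated over any
  measurable set, averages of a kernel concentrated near a point of the open set tend to the
  mean of the kernel times the measure, whereas over the avoiding set the kernel stays
  bounded however large its mean is.\<close>

section \<open>Characters of the circle and set integrals\<close>

lemma e_add: "e (x + y) = e x * e y"
  by (simp add: e_cis cis_mult distrib_left)

lemma e_of_int [simp]: "e (of_int k) = 1"
  by (simp add: e_cis cis_multiple_2pi)

lemma e_0 [simp]: "e 0 = 1"
  by (simp add: e_def)

lemma norm_e [simp]: "norm (e x) = 1"
  by (simp add: e_cis)

lemma cnj_e: "cnj (e x) = e (- x)"
  by (simp add: e_cis cis_cnj)

lemma e_mult_nat: "e (real n * x) = e x ^ n"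
  by (simp add: e_cis Complex.DeMoivre mult.left_commute)

lemma e_eq_1D: "e x = 1 \<Longrightarrow> x \<in> \<int>"
  by (auto simp: e_def exp_eq_1)

lemma continuous_on_e [continuous_intros]:
  "continuous_on A f \<Longrightarrow> continuous_on A (\<lambda>x. e (f x))"
  unfolding e_def by (intro continuous_intros)

lemma set_integrable_continuous:
  fixes f :: "real \<Rightarrow> 'b::{banach, second_countable_topology}"
  assumes "continuous_on UNIV f" "E \<in> sets lborel" "E \<subseteq> {a..b}"
  shows "set_integrable lborel E f"
  by (rule set_integrable_subset[OF borel_integrable_atLeastAtMost'[of a b]])
     (use assms in \<open>auto intro: continuous_on_subset\<close>)

lemma set_integral_sum:
  fixes f :: "'i \<Rightarrow> 'a \<Rightarrow> 'b::{banach, second_countable_topology}"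
  assumes "\<And>i. i \<in> I \<Longrightarrow> set_integrable M A (f i)"
  shows "(LINT x:A|M. \<Sum>i\<in>I. f i x) = (\<Sum>i\<in>I. LINT x:A|M. f i x)"
  using assms unfolding set_lebesgue_integral_def set_integrable_def scaleR_sum_right
  by (rule Bochner_Integration.integral_sum)

lemma set_integral_mono_subset:
  fixes f :: "_ \<Rightarrow> real"
  assumes "set_integrable M A f" "set_integrable M B f" "A \<subseteq> B" "\<And>x. x \<in> B \<Longrightarrow> f x \<ge> 0"
  shows "(LINT x:A|M. f x) \<le> (LINT x:B|M. f x)"
  using assms unfolding set_integrable_def set_lebesgue_integral_def
  by (intro integral_mono) (auto simp: indicator_def)

section \<open>Mean squares of exponential averages\<close>

lemma norm_sum_e_square:
  "complex_of_real ((norm (\<Sum>n\<in>A. e (t n)))\<^sup>2) = (\<Sum>m\<in>A. \<Sum>n\<in>A. e (t m - t n))"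
  by (simp add: complex_norm_square sum_product cnj_e flip: e_add del: of_real_power)

lemma integral_e_period:
  fixes k :: int
  shows "(LINT x:{a..a+1}|lborel. e (of_int k * x)) = (if k = 0 then 1 else 0)"
proof (cases "k = 0")
  case False
  define c where "c = 2 * complex_of_real pi * \<i> * of_int k"
  have c: "c \<noteq> 0" using False by (simp add: c_def)
  have ec: "e (of_int k * x) = exp (c * of_real x)" for x
    by (simp add: e_def c_def mult_ac)
  have "(LINT x:{a..a+1}|lborel. exp (c * of_real x)) = exp (c * of_real (a+1)) / c - exp (c * of_real a) / c"
    unfolding set_lebesgue_integral_def
  proof (rule integral_FTC_Icc)
    fix x
    show "((\<lambda>x. exp (c * complex_of_real x) / c) has_vector_derivative exp (c * of_real x)) (at x within {a..a+1})"
      using c by (auto intro!: derivative_eq_intros has_vector_derivative_real_field simp: scaleR_conv_of_real)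
  qed (auto intro!: continuous_intros)
  also have "exp (c * of_real (a+1)) = exp (c * of_real a)"
    unfolding ec[symmetric] by (simp add: distrib_left e_add)
  finally show ?thesis using False by (simp add: ec)
qed (simp add: set_lebesgue_integral_def)

text \<open>Only the diagonal survives when the square is expanded: distinct frequencies are orthogonal
  on every interval of length one.\<close>
lemma integral_norm_sum_e_square:
  fixes s :: "nat \<Rightarrow> int"
  assumes "inj s"
  shows "(LINT x:{a..a+1}|lborel. (norm (\<Sum>n<N. e (of_int (s n) * x)))\<^sup>2) = real N"
proof -
  have "complex_of_real (LINT x:{a..a+1}|lborel. (norm (\<Sum>n<N. e (of_int (s n) * x)))\<^sup>2)
      = (LINT x:{a..a+1}|lborel. (\<Sum>m<N. \<Sum>n<N. e (of_int (s m - s n) * x)))"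
    unfolding set_integral_complex_of_real[symmetric] norm_sum_e_square by (simp add: left_diff_distrib)
  also have "\<dots> = (\<Sum>m<N. \<Sum>n<N. (LINT x:{a..a+1}|lborel. e (of_int (s m - s n) * x)))"
    by (simp only: set_integral_sum set_integrable_continuous[where a = a and b = "a + 1"] 
        continuous_on_sum continuous_on_e continuous_intros order_refl atLeastAtMost_borel sets_lborel)
  also have "\<dots> = (\<Sum>m<N. \<Sum>n<N. if m = n then 1 else 0)"
    unfolding integral_e_period using assms by (auto simp: inj_eq)
  also have "\<dots> = complex_of_real (real N)" by simp
  finally show ?thesis by (simp only: of_real_eq_iff)
qed

text \<open>The frequencies are integers rather than naturals because the differences
  \<open>i - j\<close> from a squared kernel occur as multipliers.\<close>
definition exp_avg :: "(nat \<Rightarrow> int) \<Rightarrow> nat \<Rightarrow> real \<Rightarrow> complex" where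
  "exp_avg s N x = (\<Sum>n<N. e (of_int (s n) * x)) / of_nat N"

lemma continuous_on_avg: "continuous_on A (exp_avg s N)"
  unfolding exp_avg_def divide_inverse by (intro continuous_intros)

lemma integral_norm_avg_square:
  assumes "inj s"
  shows "(LINT x:{a..a+1}|lborel. (norm (exp_avg s N x))\<^sup>2) = 1 / real N"
  using integral_norm_sum_e_square[OF assms, of a N]
  by (simp add: exp_avg_def norm_divide power_divide power2_eq_square)

text \<open>Cauchy-Schwarz against the indicator of \<open>E\<close>. The bound is uniform in \<open>E\<close> and in the
  frequencies, so averages along any injective sequence vanish weakly.\<close>
lemma norm_set_integral_avg_le:
  assumes s: "inj s" and E: "E \<in> sets lborel" "E \<subseteq> {a..a+1}" and N: "N > 0"
  shows "norm (LINT x:E|lborel. exp_avg s N x) \<le> 1 / sqrt (real N)"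
proof -
  define r where "r = sqrt (real N)"
  have r: "r > 0" "real N = r * r" using N by (auto simp: r_def)
  have [simp]: "set_integrable lborel F (\<lambda>x. norm (exp_avg s N x))"
     "set_integrable lborel F (\<lambda>x. (norm (exp_avg s N x))\<^sup>2)" 
    if "F \<in> sets lborel" "F \<subseteq> {a..a+1}" for F
    using that by (auto intro!: set_integrable_continuous continuous_intros continuous_on_avg)
  have "norm (LINT x:E|lborel. exp_avg s N x) \<le> (LINT x:E|lborel. norm (exp_avg s N x))"
    by (rule set_integral_norm_bound)
       (use E in \<open>auto intro!: set_integrable_continuous continuous_on_avg\<close>)
  also have "\<dots> \<le> (LINT x:{a..a+1}|lborel. norm (exp_avg s N x))"
    using E by (intro set_integral_mono_subset) auto
  also have "\<dots> \<le> (LINT x:{a..a+1}|lborel. 1 / (2 * r) + r / 2 * (norm (exp_avg s N x))\<^sup>2)"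
  \<comment> \<open>The arithmetic-geometric mean inequality, weighted so that both terms contribute
  \<open>1 / (2 * r)\<close> to the integral.\<close>
  proof (rule set_integral_mono)
    fix x
    have "0 \<le> (r * norm (exp_avg s N x) - 1)\<^sup>2" by simp
    then show "norm (exp_avg s N x) \<le> 1 / (2 * r) + r / 2 * (norm (exp_avg s N x))\<^sup>2"
      using r by (simp add: field_simps power2_eq_square)
  qed (auto intro!: set_integrable_continuous continuous_intros continuous_on_avg)
  also have "\<dots> = 1 / (2 * r) + r / 2 * (1 / real N)"
  proof (subst set_integral_add)
    show "(LINT x:{a..a+1}|lborel. 1 / (2 * r)) + (LINT x:{a..a+1}|lborel. r / 2 * (norm (exp_avg s N x))\<^sup>2)
        = 1 / (2 * r) + r / 2 * (1 / real N)"
      unfolding set_integral_mult_right integral_norm_avg_square[OF s]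
      by (subst set_integral_const) auto
  qed (auto intro!: set_integrable_continuous continuous_intros continuous_on_avg)
  also have "\<dots> = 1 / r" using r by (simp add: field_simps)
  finally show ?thesis by (simp add: r_def)
qed

section \<open>The limit of the averages is small on an open set\<close>

text \<open>By Baire, the uniform Cauchy condition with tolerance \<open>\<delta> / 4\<close> holds from some index \<open>M\<close>
  on throughout an interval. The mean square of the \<open>N\<close>-th average is \<open>1 / N\<close>, so a late
  average is small somewhere in that interval; hence so is the \<open>M\<close>-th one, by continuity it is small
  on an open subset, and there the limit stays close to it.\<close>
lemma exp_avg_limit_small_on_open:
  assumes s: "inj s" and lim: "\<And>x. (\<lambda>N. exp_avg s N x) \<longlonglongrightarrow> \<phi> x" and d: "\<delta> > 0"
  shows "\<exists>U. open U \<and> U \<noteq> {} \<and> (\<forall>x\<in>U. norm (\<phi> x) < \<delta>)"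
proof -
  define F where "F M = {x. \<forall>N\<ge>M. norm (exp_avg s N x - exp_avg s M x) \<le> \<delta> / 4}" for M
  have closed: "closed (F M)" for M
  proof -
    have "F M = (\<Inter>N\<in>{M..}. {x. norm (exp_avg s N x - exp_avg s M x) \<le> \<delta> / 4})" by (auto simp: F_def)
    then show ?thesis
      by (simp only:) (intro closed_INT ballI closed_Collect_le continuous_intros continuous_on_avg)
  qed
  have cover: "\<exists>M. x \<in> F M" for x
  proof -
    have "Cauchy (\<lambda>N. exp_avg s N x)" using lim by (blast intro: LIMSEQ_imp_Cauchy)
    then obtain M where "\<forall>N\<ge>M. \<forall>n\<ge>M. norm (exp_avg s N x - exp_avg s n x) < \<delta> / 4"
      using d unfolding Cauchy_iff by (metis divide_pos_pos zero_less_numeral)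
    then show ?thesis by (auto simp: F_def intro!: exI[of _ M] less_imp_le)
  qed
  \<comment> \<open>If every \<open>F M\<close> had empty interior, their complements would be open dense
    sets with empty intersection.\<close>
  obtain M where M: "interior (F M) \<noteq> {}"
  proof (rule ccontr)
    assume "\<not> thesis"
    then have "interior (F M) = {}" for M using that by blast
    then have "closure (- F M) = UNIV" for M by (simp add: closure_complement)
    then have "UNIV \<subseteq> closure (\<Inter>(range (\<lambda>M. - F M)))"
      by (intro Baire) (use closed in auto)
    moreover have "\<Inter>(range (\<lambda>M. - F M)) = {}" using cover by auto
    ultimately show False by simp
  qed
  then obtain z r where z: "r > 0" "ball z r \<subseteq> F M"
    by (metis all_not_in_conv mem_interior)
  \<comment> \<open>The length is cut down to at most one, the period over which mean squares are known.\<close>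
  define a where "a = z"
  define b where "b = z + min r 1"
  have ab: "a < b" "b \<le> a + 1" "{a<..<b} \<subseteq> F M" using z
    by (auto simp: a_def b_def dist_real_def intro!: set_mp[OF z(2)])
  obtain N where N: "real N > 16 / ((b - a) * \<delta>\<^sup>2)" "N \<ge> M" "N > 0"
  proof -
    obtain n where "real n > 16 / ((b - a) * \<delta>\<^sup>2)" using reals_Archimedean2 by blast
    then show ?thesis by (intro that[of "max n (max M 1)"]) auto
  qed
  have "\<exists>x\<in>{a<..<b}. norm (exp_avg s N x) < \<delta> / 4"
  proof (rule ccontr)
    assume "\<not> ?thesis"
    then have big: "\<delta> / 4 \<le> norm (exp_avg s N x)" if "x \<in> {a<..<b}" for x using that by force
    have "(b - a) * (\<delta> / 4)\<^sup>2 = (LINT x:{a<..<b}|lborel. (\<delta> / 4)\<^sup>2)"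
      using ab by (simp add: set_integral_const)
    also have "\<dots> \<le> (LINT x:{a<..<b}|lborel. (norm (exp_avg s N x))\<^sup>2)"
      using big d
      by (intro set_integral_mono set_integrable_continuous[where a = a and b = b] continuous_intros
          continuous_on_avg power_mono) auto
    also have "\<dots> \<le> (LINT x:{a..a+1}|lborel. (norm (exp_avg s N x))\<^sup>2)"
      using ab by (intro set_integral_mono_subset set_integrable_continuous[where a = a and b = "a+1"]
         continuous_intros continuous_on_avg) auto
    also have "\<dots> = 1 / real N" by (rule integral_norm_avg_square[OF s])
    finally show False using N ab d by (simp add: field_simps power2_eq_square)
  qed
  then obtain x where x: "x \<in> {a<..<b}" "norm (exp_avg s N x) < \<delta> / 4" by blast
  have "norm (exp_avg s N x - exp_avg s M x) \<le> \<delta> / 4" using x ab N by (auto simp: F_def)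
  then have xM: "norm (exp_avg s M x) < \<delta> / 2"
    using x norm_triangle_ineq2[of "exp_avg s M x" "exp_avg s N x"] by (simp add: norm_minus_commute)
  define U where "U = {a<..<b} \<inter> {x. norm (exp_avg s M x) < \<delta> / 2}"
  have "norm (\<phi> y) < \<delta>" if y: "y \<in> U" for y
  proof -
    have "norm (\<phi> y - exp_avg s M y) \<le> \<delta> / 4"
    proof (rule tendsto_upperbound)
      show "(\<lambda>N. norm (exp_avg s N y - exp_avg s M y)) \<longlonglongrightarrow> norm (\<phi> y - exp_avg s M y)"
        by (intro tendsto_intros lim)
      show "\<forall>\<^sub>F N in sequentially. norm (exp_avg s N y - exp_avg s M y) \<le> \<delta> / 4"
        using ab(3) y unfolding eventually_sequentially
        by (intro exI[of _ M]) (auto simp: U_def F_def subset_iff)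
    qed simp
    then show ?thesis using y d norm_triangle_ineq2[of "\<phi> y" "exp_avg s M y"] by (auto simp: U_def)
  qed
  moreover have "open U" unfolding U_def
    by (intro open_Int open_Collect_less continuous_intros continuous_on_avg)
  ultimately show ?thesis using x xM by (intro exI[of _ U]) (auto simp: U_def)
qed

section \<open>Almost every point has a dense orbit under infinitely many multiplications\<close>

text \<open>Away from the integers \<open>1 - e x\<close> is bounded below by compactness, and summing the geometric
  series bounds the Dirichlet kernel by a constant independent of its length \<open>m\<close>.\<close>
lemma bounded_dirichlet_kernel:
  assumes "open U" "y \<in> U"
  shows "\<exists>C. \<forall>x m. (\<forall>k::int. x + y + of_int k \<notin> U) \<longrightarrow> (norm (\<Sum>j<m. e (real j * x)))\<^sup>2 \<le> C"
proof -
  obtain r where r: "r > 0" "ball y r \<subseteq> U" using assms by (meson openE)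
  define \<eta> where "\<eta> = min r (1/2)"
  have "\<exists>t\<in>{\<eta>..1-\<eta>}. \<forall>u\<in>{\<eta>..1-\<eta>}. norm (1 - e t) \<le> norm (1 - e u)"
    by (rule continuous_attains_inf) (auto simp: \<eta>_def intro!: continuous_intros)
  then obtain t where t: "t \<in> {\<eta>..1-\<eta>}" "\<And>u. u \<in> {\<eta>..1-\<eta>} \<Longrightarrow> norm (1 - e t) \<le> norm (1 - e u)"
    by blast
  define c where "c = norm (1 - e t)"
  have "0 < t" "t < 1" using t r by (auto simp: \<eta>_def)
  then have "t \<notin> \<int>" by (auto elim!: Ints_cases)
  then have "e t \<noteq> 1" using e_eq_1D by blast
  then have c: "c > 0" by (simp add: c_def)
  have "(norm (\<Sum>j<m. e (real j * x)))\<^sup>2 \<le> (2 / c)\<^sup>2" if x: "\<forall>k::int. x + y + of_int k \<notin> U" for x m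
  proof -
    define u where "u = x - of_int \<lfloor>x\<rfloor>"
    have "u \<ge> 0" "u < 1" unfolding u_def by linarith+
    have "x + y + of_int (- \<lfloor>x\<rfloor>) \<notin> ball y r" "x + y + of_int (- \<lfloor>x\<rfloor> - 1) \<notin> ball y r"
      using x r by blast+
    then have "u \<in> {\<eta>..1-\<eta>}"
      using \<open>u \<ge> 0\<close> \<open>u < 1\<close> by (auto simp: u_def \<eta>_def dist_real_def)
    moreover have "e x = e u" using e_add[of u "of_int \<lfloor>x\<rfloor>"] by (simp add: u_def)
    ultimately have "c \<le> norm (1 - e x)" using t by (simp add: c_def)
    then have "c * norm (\<Sum>j<m. e (real j * x)) \<le> norm (1 - e x) * norm (\<Sum>j<m. e x ^ j)"
      by (simp add: e_mult_nat mult_right_mono)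
    also have "\<dots> = norm (1 - e x ^ m)"
      by (simp add: one_diff_power_eq norm_mult)
    also have "\<dots> \<le> 2"
      using norm_triangle_ineq4[of 1 "e x ^ m"] by (simp add: norm_power)
    finally show ?thesis using c by (intro power_mono) (auto simp: field_simps)
  qed
  then show ?thesis by blast
qed

text \<open>Expanding the square of the kernel turns its average along \<open>p n * x - y\<close> into exponential
  averages. The diagonal terms \<open>i = j\<close> have frequency zero and add up to \<open>m\<close>; in all others the
  frequencies are injective in \<open>n\<close> whenever \<open>p\<close> is.\<close>
lemma avg_norm_sum_e_square:
  fixes p :: "nat \<Rightarrow> nat"
  shows "complex_of_real ((\<Sum>n<N. (norm (\<Sum>j<m. e (real j * (real (p n) * x - y))))\<^sup>2) / real N)
    = (\<Sum>i<m. \<Sum>j<m. e (- (real i - real j) * y) * exp_avg (\<lambda>n. (int i - int j) * int (p n)) N x)"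
proof -
  have "complex_of_real ((\<Sum>n<N. (norm (\<Sum>j<m. e (real j * (real (p n) * x - y))))\<^sup>2) / real N)
     = (\<Sum>n<N. \<Sum>i<m. \<Sum>j<m. e (- (real i - real j) * y) * e ((real i - real j) * real (p n) * x)) / of_nat N"
    unfolding of_real_divide of_real_sum norm_sum_e_square e_add[symmetric]
    by (simp add: algebra_simps)
  also have "(\<Sum>n<N. \<Sum>i<m. \<Sum>j<m. e (- (real i - real j) * y) * e ((real i - real j) * real (p n) * x))
     = (\<Sum>i<m. \<Sum>j<m. \<Sum>n<N. e (- (real i - real j) * y) * e ((real i - real j) * real (p n) * x))"
    by (subst sum.swap) (intro sum.cong refl sum.swap)
  finally show ?thesis
    by (simp add: exp_avg_def sum_divide_distrib sum_distrib_left)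
qed

text \<open>Let \<open>E\<close> be the set in question and \<open>y \<in> U\<close>. On \<open>E\<close> the squared Dirichlet kernel of length
  \<open>m\<close>, evaluated at \<open>p * x - y\<close>, is at most a constant \<open>C\<close>. Integrating its averages over \<open>p\<close>
  against \<open>E\<close>, the off-diagonal terms vanish in the limit and the diagonal ones leave \<open>m\<close> times the
  measure of \<open>E\<close>. Thus \<open>m |E| \<le> C |E|\<close> for every \<open>m\<close>, and \<open>|E| = 0\<close>.\<close>
lemma missing_open_null:
  fixes P :: "nat set" and U :: "real set"
  assumes P: "infinite P" and U: "open U" "U \<noteq> {}"
  shows "{x \<in> {0..1}. \<forall>p\<in>P. \<forall>k::int. real p * x + of_int k \<notin> U} \<in> null_sets lborel"
proof -
  define E where "E = {x \<in> {0..1}. \<forall>p\<in>P. \<forall>k::int. real p * x + of_int k \<notin> U}"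
  have E_eq: "E = {0..1} \<inter> (\<Inter>p\<in>P. \<Inter>k::int. (\<lambda>x. real p * x + of_int k) -` (- U))"
    by (auto simp: E_def)
  have "closed E" unfolding E_eq using U
    by (intro closed_Int closed_INT ballI closed_vimage continuous_intros) auto
  then have E: "E \<in> sets lborel" "E \<subseteq> {0..0+1}" by (auto simp: E_eq)
  have fin: "emeasure lborel E < \<infinity>"
    by (rule le_less_trans[OF emeasure_mono[of E "{0..1}"]]) (use E in auto)
  define p where "p = enumerate P"
  have p: "p n \<in> P" "inj p" for n using P
    by (auto simp: p_def enumerate_in_set strict_mono_enumerate strict_mono_imp_inj_on)
  obtain y where y: "y \<in> U" using U by blast
  obtain C where C: "\<And>x m. (\<forall>k::int. x + y + of_int k \<notin> U) \<Longrightarrow> (norm (\<Sum>j<m. e (real j * x)))\<^sup>2 \<le> C"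
    using bounded_dirichlet_kernel[OF U(1) y] by blast
  obtain m where m: "real m > C" using reals_Archimedean2 by blast
  define G where "G N x = (\<Sum>n<N. (norm (\<Sum>j<m. e (real j * (real (p n) * x - y))))\<^sup>2) / real N" for N x
  note int = set_integrable_continuous[OF _ E]
  have contG: "continuous_on UNIV (G N)" for N
    unfolding G_def divide_inverse by (intro continuous_intros)
  have "(\<lambda>N. LINT x:E|lborel. complex_of_real (G N x)) \<longlonglongrightarrow>
     (\<Sum>i<m. \<Sum>j<m. e (- (real i - real j) * y) * (if i = j then complex_of_real (measure lborel E) else 0))"
  proof -
    have "(LINT x:E|lborel. complex_of_real (G N x)) = (\<Sum>i<m. \<Sum>j<m. e (- (real i - real j) * y) *
        (LINT x:E|lborel. exp_avg (\<lambda>n. (int i - int j) * int (p n)) N x))" for N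
      unfolding G_def avg_norm_sum_e_square
      by (simp only: set_integral_sum int continuous_on_sum continuous_on_mult
           continuous_on_const continuous_on_avg set_integral_mult_right)
    moreover have "(\<lambda>N. LINT x:E|lborel. exp_avg (\<lambda>n. (int i - int j) * int (p n)) N x)
        \<longlonglongrightarrow> (if i = j then complex_of_real (measure lborel E) else 0)" for i j
    proof (cases "i = j")
      case True
      have "(LINT x:E|lborel. exp_avg (\<lambda>n. 0) N x) = complex_of_real (measure lborel E)" if "N > 0" for N
        using that fin E by (simp add: exp_avg_def set_integral_const scaleR_conv_of_real)
      then show ?thesis using True
        by (auto intro!: tendsto_eventually exI[of _ 1] simp: eventually_sequentially)
    next
      case False
      then have inj: "inj (\<lambda>n. (int i - int j) * int (p n))"
        using p(2) by (auto simp: inj_def)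
      have "(\<lambda>N. LINT x:E|lborel. exp_avg (\<lambda>n. (int i - int j) * int (p n)) N x) \<longlonglongrightarrow> 0"
      proof (rule Lim_null_comparison)
        show "\<forall>\<^sub>F N in sequentially. norm (LINT x:E|lborel. exp_avg (\<lambda>n. (int i - int j) * int (p n)) N x)
            \<le> 1 / sqrt (real N)"
          using norm_set_integral_avg_le[OF inj E] by (auto simp: eventually_sequentially intro!: exI[of _ 1])
        show "(\<lambda>N. 1 / sqrt (real N)) \<longlonglongrightarrow> 0"
          by (intro tendsto_divide_0[OF tendsto_const] filterlim_at_top_imp_at_infinity
               filterlim_compose[OF sqrt_at_top] filterlim_real_sequentially)
      qed
      with False show ?thesis by simp
    qed
    ultimately show ?thesis by (simp only:) (intro tendsto_intros)
  qed
  also have "(\<Sum>i<m. \<Sum>j<m. e (- (real i - real j) * y) * (if i = j then complex_of_real (measure lborel E) else 0))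
     = (\<Sum>i<m. \<Sum>j<m. if i = j then complex_of_real (measure lborel E) else 0)"
    by (intro sum.cong refl) auto
  also have "\<dots> = complex_of_real (real m * measure lborel E)" by simp
  finally have "(\<lambda>N. LINT x:E|lborel. G N x) \<longlonglongrightarrow> real m * measure lborel E"
    unfolding set_integral_complex_of_real tendsto_of_real_iff .
  moreover have "(LINT x:E|lborel. G N x) \<le> C * measure lborel E" if "N > 0" for N
  proof -
    have "(LINT x:E|lborel. G N x) \<le> (LINT x:E|lborel. C)"
    proof (rule set_integral_mono)
      fix x assume x: "x \<in> E"
      have "(\<Sum>n<N. (norm (\<Sum>j<m. e (real j * (real (p n) * x - y))))\<^sup>2) \<le> (\<Sum>n<N. C)"
        using x p by (intro sum_mono C) (auto simp: E_def)
      then show "G N x \<le> C" using that by (simp add: G_def field_simps)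
    qed (auto intro!: int contG)
    then show ?thesis using E fin by (simp add: set_integral_const mult.commute)
  qed
  ultimately have "real m * measure lborel E \<le> C * measure lborel E"
    by (intro tendsto_upperbound) (auto simp: eventually_sequentially intro!: exI[of _ 1])
  then have "measure lborel E \<le> 0" using m
    by (metis mult_right_less_imp_less measure_nonneg not_le mult_less_cancel_right)
  then have "emeasure lborel E = 0" using fin
    by (metis emeasure_eq_ennreal_measure ennreal_neg infinity_ennreal_def less_irrefl)
  then show ?thesis using E by (auto simp: null_sets_def E_def)
qed

lemma to_torus_in_image_iff: "to_torus x \<in> to_torus ` U \<longleftrightarrow> (\<exists>k::int. x + of_int k \<in> U)"
proof
  assume "to_torus x \<in> to_torus ` U"
  then obtain u where u: "u \<in> U" "u - x \<in> \<int>" by (auto simp flip: to_torus_eq_iff)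
  then obtain k where "u - x = of_int k" by (auto elim: Ints_cases)
  then have "x + of_int k = u" by simp
  with u show "\<exists>k::int. x + of_int k \<in> U" by metis
next
  assume "\<exists>k::int. x + of_int k \<in> U"
  then obtain k :: int where "x + of_int k \<in> U" ..
  moreover have "to_torus x = to_torus (x + of_int k)" by (simp add: to_torus_eq_iff)
  ultimately show "to_torus x \<in> to_torus ` U" by simp
qed

lemma open_image_to_torus:
  assumes "open U"
  shows "open (to_torus ` U)"
proof -
  have "to_torus -` to_torus ` U = (\<Union>k::int. (\<lambda>x. x + of_int k) -` U)"
    by (rule set_eqI) (simp add: to_torus_in_image_iff)
  then show ?thesis unfolding open_torus_def using assms
    by (simp only:) (intro open_UN ballI open_vimage continuous_intros)
qed

lemma torus_mult_to_torus: "torus_mult n (to_torus x) = to_torus (real n * x)"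
  by (rule torus_mult.abs_eq)

lemma torus_e_to_torus: "torus_e (to_torus x) = e x"
  by (rule torus_e.abs_eq)

lemma continuous_on_torus_mult: "continuous_on UNIV (torus_mult n)"
proof -
  have "open (torus_mult n -` B)" if "open B" for B
  proof -
    have "to_torus -` torus_mult n -` B = (\<lambda>x. real n * x) -` to_torus -` B"
      by (auto simp: torus_mult_to_torus)
    also have "open \<dots>"
      using that by (intro open_vimage continuous_on_to_torus continuous_intros)
    finally show ?thesis by (simp add: open_torus_def)
  qed
  then show ?thesis by (simp add: continuous_on_open_vimage)
qed

text \<open>The points whose multiples by elements of \<open>P\<close> are dense in the torus. Restricting to
  rational intervals keeps the intersection countable, so that the set is Borel and null
  exceptional sets can be collected.\<close>
definition dense_orbit_points :: "nat set \<Rightarrow> torus set" where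
  "dense_orbit_points P = (\<Inter>(a, b)\<in>{(a, b) \<in> \<rat> \<times> \<rat>. a < b}. \<Union>p\<in>P. torus_mult p -` (to_torus ` {a<..<b}))"

lemma countable_rational_intervals: "countable {(a, b) \<in> \<rat> \<times> \<rat>. a < (b::real)}"
  by (rule countable_subset[of _ "\<rat> \<times> \<rat>"]) (auto intro: countable_rat)

lemma borel_dense_orbit_points: "dense_orbit_points P \<in> sets borel"
proof -
  have "(\<Union>p\<in>P. torus_mult p -` (to_torus ` {a<..<b})) \<in> sets borel" for a b
    by (intro borel_open open_UN ballI open_vimage continuous_on_torus_mult open_image_to_torus) auto
  moreover have "(0, 1) \<in> {(a, b) \<in> \<rat> \<times> \<rat>. a < (b::real)}" by simp
  then have "{(a, b) \<in> \<rat> \<times> \<rat>. a < (b::real)} \<noteq> {}" by blast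
  ultimately show ?thesis
    unfolding dense_orbit_points_def
    by (intro sets.countable_INT' countable_rational_intervals) auto
qed

lemma dense_orbit_pointsD:
  assumes "to_torus x \<in> dense_orbit_points P" "open U" "U \<noteq> {}"
  shows "\<exists>p\<in>P. \<exists>k::int. real p * x + of_int k \<in> U"
proof -
  obtain y where "y \<in> U" using assms by blast
  then obtain r where r: "r > 0" "ball y r \<subseteq> U" using assms by (meson openE)
  obtain a where a: "a \<in> \<rat>" "y - r < a" "a < y" using Rats_dense_in_real[of "y - r" y] r by auto
  obtain b where b: "b \<in> \<rat>" "y < b" "b < y + r" using Rats_dense_in_real[of y "y + r"] r by auto
  have "{a<..<b} \<subseteq> U" using a b by (intro subset_trans[OF _ r(2)]) (auto simp: dist_real_def)
  moreover have "(a, b) \<in> {(a, b) \<in> \<rat> \<times> \<rat>. a < b}" using a b by auto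
  then have "to_torus x \<in> (\<Union>p\<in>P. torus_mult p -` (to_torus ` {a<..<b}))"
    using assms(1) unfolding dense_orbit_points_def by fast
  ultimately show ?thesis
    by (simp add: torus_mult_to_torus to_torus_in_image_iff) (meson greaterThanLessThan_iff subsetD)
qed

lemma emeasure_dense_orbit_points:
  assumes "infinite P"
  shows "emeasure torus_lebesgue (dense_orbit_points P) = 1"
proof -
  let ?M = "restrict_space lborel {0..<1::real}"
  have "prob_space ?M"
    by (rule prob_spaceI) (simp add: emeasure_restrict_space space_restrict_space)
  moreover have meas: "to_torus \<in> ?M \<rightarrow>\<^sub>M borel"
    by (rule measurable_restrict_space1) simp
  ultimately interpret prob_space "distr ?M borel to_torus"
    by (rule prob_space.prob_space_distr)
  have "AE x in lborel. x \<in> {0..<1} \<longrightarrow> (\<exists>p\<in>P. \<exists>k::int. real p * x + of_int k \<in> {a<..<b})"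
    if "a < b" for a b
    by (rule AE_I'[OF missing_open_null[OF assms, of "{a<..<b}"]]) (use that in auto)
  then have "AE x in lborel. \<forall>(a,b)\<in>{(a, b) \<in> \<rat> \<times> \<rat>. a < b}. x \<in> {0..<1} \<longrightarrow>
      (\<exists>p\<in>P. \<exists>k::int. real p * x + of_int k \<in> {a<..<b})"
    by (subst AE_ball_countable[OF countable_rational_intervals]) auto
  then have "AE x in lborel. x \<in> {0..<1} \<longrightarrow> to_torus x \<in> dense_orbit_points P"
    by eventually_elim
       (auto simp: dense_orbit_points_def torus_mult_to_torus to_torus_in_image_iff)
  then have "AE x in distr ?M borel to_torus. x \<in> dense_orbit_points P"
    by (subst AE_distr_iff[OF meas])
       (auto simp: borel_dense_orbit_points AE_restrict_space_iff)
  then have "emeasure (distr ?M borel to_torus) (dense_orbit_points P) = 1"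
    by (simp add: emeasure_eq_1_AE borel_dense_orbit_points)
  then show ?thesis
    by (simp add: torus_lebesgue_def borel_dense_orbit_points)
qed

section \<open>Representable measures\<close>

text \<open>The function \<open>x \<mapsto> e(p x)\<close> is continuous and bounded on the torus, so weak convergence can
  be tested on its real and imaginary parts.\<close>
lemma representable_fourier:
  assumes nu: "borel_prob \<nu>" and w: "weakly_converges (empirical_measure S (to_torus a)) \<nu>"
  shows "(\<lambda>N. exp_avg (\<lambda>n. int (enumerate S n)) N (real p * a)) \<longlonglongrightarrow> (\<integral>x. torus_e (torus_mult p x) \<partial>\<nu>)"
proof -
  interpret prob_space \<nu> using nu by (simp add: borel_prob_def)
  define g where "g = (\<lambda>x. torus_e (torus_mult p x))"
  have cont: "continuous_on UNIV g" unfolding g_def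
    by (rule continuous_on_compose2[OF continuous_on_torus_e continuous_on_torus_mult]) auto
  have g1: "norm (g x) = 1" for x
    unfolding g_def by (induct x rule: torus.abs_induct) (simp add: torus_mult_to_torus torus_e_to_torus)
  have "g \<in> borel_measurable \<nu>"
    using borel_measurable_continuous_onI[OF cont] nu
    by (simp add: borel_prob_def cong: measurable_cong_sets)
  then have int: "integrable \<nu> g"
    by (intro integrable_const_bound[of _ 1]) (auto simp: g1)
  have g_emp: "g (torus_mult s (to_torus a)) = e (real s * (real p * a))" for s
    by (simp add: g_def torus_mult_to_torus torus_e_to_torus mult_ac)
  have conv: "(\<lambda>N. (\<Sum>n<N. f (torus_mult (enumerate S n) (to_torus a))) / real N) \<longlonglongrightarrow> (\<integral>x. f x \<partial>\<nu>)"
    if "continuous_on UNIV f" "\<And>x. \<bar>f x\<bar> \<le> 1" for f :: "torus \<Rightarrow> real"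
  proof -
    have "bounded (range f)" using that(2) by (auto simp: bounded_iff)
    then have "(\<lambda>N. \<integral>x. f x \<partial>empirical_measure S (to_torus a) N) \<longlonglongrightarrow> (\<integral>x. f x \<partial>\<nu>)"
      using w that(1) by (auto simp: weakly_converges_def)
    then show ?thesis
      unfolding integral_empirical_measure[OF that(1)] by (simp add: sum.atLeast1_atMost_eq)
  qed
  have Re: "(\<lambda>N. (\<Sum>n<N. Re (g (torus_mult (enumerate S n) (to_torus a)))) / real N) \<longlonglongrightarrow> (\<integral>x. Re (g x) \<partial>\<nu>)"
    and Im: "(\<lambda>N. (\<Sum>n<N. Im (g (torus_mult (enumerate S n) (to_torus a)))) / real N) \<longlonglongrightarrow> (\<integral>x. Im (g x) \<partial>\<nu>)"
    by (auto intro!: conv continuous_intros cont) (metis abs_Re_le_cmod abs_Im_le_cmod g1)+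
  show ?thesis
    unfolding tendsto_complex_iff g_def[symmetric]
    using Re Im by (simp add: exp_avg_def g_emp int flip: g_def)
qed

theorem mainTheorem3:
  fixes \<nu> :: "torus measure"
  assumes "borel_prob \<nu>"
    and "limsup (\<lambda>p::nat. ereal (norm (\<integral>x. torus_e (torus_mult p x) \<partial>\<nu>))) > 0"
  shows "\<exists>A. A \<in> sets torus_lebesgue \<and> emeasure torus_lebesgue A = 1 \<and>
           (\<forall>\<alpha>\<in>A. \<not> representable_at \<nu> \<alpha>)"
proof -
  define c where "c p = (\<integral>x. torus_e (torus_mult p x) \<partial>\<nu>)" for p
  obtain \<delta> where \<delta>: "\<delta> > 0" "ereal \<delta> < limsup (\<lambda>p. ereal (norm (c p)))"
    using ereal_dense2[OF assms(2)] by (auto simp: c_def zero_ereal_def)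
  define P where "P = {p. \<delta> < norm (c p)}"
  have "infinite P"
  proof
    assume "finite P"
    then have "\<forall>\<^sub>F p in sequentially. ereal (norm (c p)) \<le> ereal \<delta>"
      by (auto simp: P_def eventually_cofinite not_le simp flip: cofinite_eq_sequentially)
    then have "limsup (\<lambda>p. ereal (norm (c p))) \<le> ereal \<delta>" by (rule Limsup_bounded)
    with \<delta> show False by simp
  qed
  moreover have "\<not> representable_at \<nu> \<alpha>" if \<alpha>: "\<alpha> \<in> dense_orbit_points P" for \<alpha>
  proof
    assume "representable_at \<nu> \<alpha>"
    then obtain S where S: "good_set S" "weakly_converges (empirical_measure S \<alpha>) \<nu>"
      by (auto simp: representable_at_def)
    obtain a where a: "\<alpha> = to_torus a" by (induct \<alpha> rule: torus.abs_induct) auto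
    define s where "s = (\<lambda>n. int (enumerate S n))"
    have "inj s" using S(1) strict_mono_imp_inj_on[OF strict_mono_enumerate]
      by (auto simp: s_def good_set_def inj_def)
    moreover have "\<exists>l. (\<lambda>N. exp_avg s N x) \<longlonglongrightarrow> l" for x
      using S(1) by (auto simp: good_set_def convergent_def exp_avg_def s_def sum.atLeast1_atMost_eq)
    then obtain \<phi> where \<phi>: "\<And>x. (\<lambda>N. exp_avg s N x) \<longlonglongrightarrow> \<phi> x" by metis
    ultimately obtain U where U: "open U" "U \<noteq> {}" "\<And>x. x \<in> U \<Longrightarrow> norm (\<phi> x) < \<delta>"
      using exp_avg_limit_small_on_open[of s \<phi> \<delta>] \<delta>(1) by blast
    obtain p and k :: int where p: "p \<in> P" "real p * a + of_int k \<in> U"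
      using dense_orbit_pointsD[of a P U] \<alpha> U a by blast
    \<comment> \<open>The averages have period one, so the representative
    \<open>real p * a + of_int k\<close> in \<open>U\<close> is as good as \<open>real p * a\<close>.\<close>
    have "exp_avg s N (real p * a + of_int k) = exp_avg s N (real p * a)" for N
      by (simp add: exp_avg_def distrib_left e_add flip: of_int_mult)
    then have "(\<lambda>N. exp_avg s N (real p * a)) \<longlonglongrightarrow> \<phi> (real p * a + of_int k)"
      using \<phi>[of "real p * a + of_int k"] by simp
    moreover have "(\<lambda>N. exp_avg s N (real p * a)) \<longlonglongrightarrow> c p"
      using representable_fourier[OF assms(1)] S(2) unfolding a s_def c_def by blast
    ultimately have "\<phi> (real p * a + of_int k) = c p" by (rule LIMSEQ_unique)
    then show False using U(3)[OF p(2)] p(1) by (simp add: P_def)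
  qed
  moreover have "dense_orbit_points P \<in> sets torus_lebesgue"
    using borel_dense_orbit_points by (simp add: torus_lebesgue_def sets_completionI_sets)
  ultimately show ?thesis using emeasure_dense_orbit_points by blast
qed

end
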